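(* Let $\Phi:(S,\cdot)\to(T,\cdot)$ be a semigroup homomorphism such that $\Phi(S)$ is a $J$-set in $T$. If $A\subseteq S$ is a $J$-set in $S$, then $\Phi(A)$ is a $J$-set in $T$.
   Context: For a semigroup $(X,\cdot)$ and a set $Y$, $\mathcal P_f(Y)$ denotes the set of finite nonempty subsets of $Y$. Let $\mathcal T_X={}^{\mathbb N}X$ be the set of sequences in $X$; for $m\in\mathbb N$ let $\mathcal J_m=\{(t(1),\dots,t(m))\in\mathbb N^m: t(1)<\dots<t(m)\}$; for $a\in X^{m+1}$, $t\in\mathcal J_m$ and $f\in\mathcal T_X$ put $x(m,a,t,f)=\bigl(\prod_{j=1}^m a(j)\cdot f(t(j))\bigr)\cdot a(m+1)$ (product in increasing order of $j$). A set $B\subseteq X$ is a $J$-set in $X$ if for each $F\in\mathcal P_f(\mathcal T_X)$ there exist $m\in\mathbb N$, $a\in X^{m+1}$ and $t\in\mathcal J_m$ such that $x(m,a,t,f)\in B$ for every $f\in F$. *)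

theory Defs
  imports Main
begin

text \<open>
  A semigroup is a type of class \<open>semigroup_mult\<close>. \<open>\<nat>\<close> is the set of positive integers.
  Sequences and tuples are total functions on \<^typ>\<open>nat\<close>: only the values of a sequence at
  positive indices, the entries \<open>a 1, \<dots>, a (m + 1)\<close> and the entries \<open>t 1, \<dots>, t m\<close> are ever used.
\<close>

definition semigroup_hom :: "('a::semigroup_mult \<Rightarrow> 'b::semigroup_mult) \<Rightarrow> bool" where
  "semigroup_hom \<phi> \<longleftrightarrow> (\<forall>x y. \<phi> (x * y) = \<phi> x * \<phi> y)"

text \<open>
  \<open>ordered_prod g m\<close> is \<open>g 1 * g 2 * \<dots> * g m\<close> for \<open>m \<ge> 1\<close>. There need not be a unit, so the
  product starts from \<open>g 1\<close>; the value at \<open>m = 0\<close> is irrelevant.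
\<close>

definition ordered_prod :: "(nat \<Rightarrow> 'a::semigroup_mult) \<Rightarrow> nat \<Rightarrow> 'a" where
  "ordered_prod g m = foldl (\<lambda>p j. p * g j) (g 1) [2..<Suc m]"

definition increasing_tuples :: "nat \<Rightarrow> (nat \<Rightarrow> nat) set" where
  "increasing_tuples m = {t. (\<forall>j\<in>{1..m}. 1 \<le> t j) \<and> strict_mono_on {1..m} t}"

definition x_prod ::
  "nat \<Rightarrow> (nat \<Rightarrow> 'a::semigroup_mult) \<Rightarrow> (nat \<Rightarrow> nat) \<Rightarrow> (nat \<Rightarrow> 'a) \<Rightarrow> 'a" where
  "x_prod m a t f = ordered_prod (\<lambda>j. a j * f (t j)) m * a (m + 1)"

definition J_set :: "'a::semigroup_mult set \<Rightarrow> bool" where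
  "J_set B \<longleftrightarrow>
    (\<forall>F :: (nat \<Rightarrow> 'a) set. finite F \<and> F \<noteq> {} \<longrightarrow>
      (\<exists>m \<ge> 1. \<exists>a :: nat \<Rightarrow> 'a. \<exists>t \<in> increasing_tuples m. \<forall>f\<in>F. x_prod m a t f \<in> B))"

end

theory Submission
  imports Defs
begin

text \<open>
  Shifting sequences shows that the indices witnessing that \<open>range \<Phi>\<close> is a \<open>J\<close>-set can be chosen
  beyond any bound. For a finite set \<open>F\<close> of sequences in the target one therefore gets consecutive
  blocks of indices, the \<open>n\<close>-th carrying a product \<open>w\<^sub>n\<close> with \<open>w\<^sub>n f = \<Phi> (g\<^sub>f n)\<close> for all \<open>f \<in> F\<close>.
  Apply the \<open>J\<close>-set property of \<open>A\<close> to the sequences \<open>g\<^sub>f\<close> and map the resulting product by \<open>\<Phi>\<close>: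
  replacing each \<open>\<Phi> (g\<^sub>f n)\<close> by \<open>w\<^sub>n f\<close> and merging adjacent coefficients yields a product of the
  required form in the target.
\<close>

text \<open>
  \<open>x_word lo hi w\<close> says that \<open>w\<close> is \<open>x_prod m a t\<close> for some \<open>m \<ge> 1\<close> and \<open>a\<close> and some increasing
  tuple \<open>t\<close> with entries in \<open>{lo<..hi}\<close>. The bounds make such products composable without any
  explicit reindexing.
\<close>

inductive x_word :: "nat \<Rightarrow> nat \<Rightarrow> ((nat \<Rightarrow> 'a::semigroup_mult) \<Rightarrow> 'a) \<Rightarrow> bool" where
  single: "lo < t \<Longrightarrow> t \<le> hi \<Longrightarrow> x_word lo hi (\<lambda>f. a * f t * b)"
| snoc: "x_word lo k w \<Longrightarrow> k < t \<Longrightarrow> t \<le> hi \<Longrightarrow> x_word lo hi (\<lambda>f. w f * f t * b)"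

lemma x_word_less: "x_word lo hi w \<Longrightarrow> lo < hi"
  by (induction rule: x_word.induct) auto

lemma x_word_mono: "x_word lo hi w \<Longrightarrow> lo' \<le> lo \<Longrightarrow> hi \<le> hi' \<Longrightarrow> x_word lo' hi' w"
proof (induction arbitrary: hi' rule: x_word.induct)
  case (single lo t hi a b)
  then show ?case by (simp add: x_word.single)
next
  case (snoc lo k w t hi b)
  then show ?case using x_word.snoc[of lo' k w t hi' b] by simp
qed

lemma x_word_shift:
  "x_word lo hi w \<Longrightarrow> x_word (lo + n) (hi + n) (\<lambda>f. w (\<lambda>i. f (i + n)))"
  by (induction rule: x_word.induct) (auto intro: x_word.intros)

text \<open>The factor is absorbed into the first coefficient, which sits at the base of the
  derivation; hence the induction.\<close>

lemma x_word_mult_left: "x_word lo hi w \<Longrightarrow> x_word lo hi (\<lambda>f. c * w f)"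
proof (induction rule: x_word.induct)
  case (single lo t hi a b)
  then show ?case
    using x_word.single[of lo t hi "c * a" b] by (simp add: mult.assoc)
next
  case (snoc lo k w t hi b)
  then show ?case
    using x_word.snoc[of lo k "\<lambda>f. c * w f" t hi b] by (simp add: mult.assoc)
qed

lemma x_word_mult_right:
  assumes "x_word lo hi w"
  shows "x_word lo hi (\<lambda>f. w f * c)"
  using assms
proof cases
  case (single t a b)
  then show ?thesis
    using x_word.single[of lo t hi a "b * c"] by (simp add: mult.assoc)
next
  case (snoc k w t b)
  then show ?thesis
    using x_word.snoc[of lo k w t hi "b * c"] by (simp add: mult.assoc)
qed

text \<open>Induction on the later word \<open>v\<close>: in the base case the last coefficient of
  \<open>w\<close> absorbs the first coefficient of \<open>v\<close>.\<close>

lemma x_word_mult: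
  assumes "x_word k hi v" "x_word lo k w"
  shows "x_word lo hi (\<lambda>f. w f * v f)"
  using assms
proof (induction rule: x_word.induct)
  case (single k t hi a b)
  then show ?case
    using x_word.snoc[OF x_word_mult_right, of lo k w t hi a b] by (simp add: mult.assoc)
next
  case (snoc k l v t hi b)
  then show ?case
    using x_word.snoc[of lo l "\<lambda>f. w f * v f" t hi b] by (simp add: mult.assoc)
qed

lemma x_prod_1: "x_prod (Suc 0) a t f = a 1 * f (t 1) * a 2"
  by (simp add: x_prod_def ordered_prod_def numeral_2_eq_2)

text \<open>The coefficient \<open>a (Suc m)\<close> closes the shorter product and stands before
  \<open>f (t (Suc m))\<close> in the longer one.\<close>

lemma x_prod_Suc:
  "m \<ge> 1 \<Longrightarrow> x_prod (Suc m) a t f = x_prod m a t f * f (t (Suc m)) * a (Suc (Suc m))"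
  by (simp add: x_prod_def ordered_prod_def mult.assoc)

lemma x_prod_cong:
  assumes "m \<ge> 1" "\<And>j. j \<in> {1..Suc m} \<Longrightarrow> a j = a' j" "\<And>j. j \<in> {1..m} \<Longrightarrow> t j = t' j"
  shows "x_prod m a t f = x_prod m a' t' f"
  using assms
proof (induction m rule: nat_induct_at_least)
  case base
  then show ?case by (simp add: x_prod_1)
next
  case (Suc m)
  then show ?case by (simp add: x_prod_Suc)
qed

lemma x_word_x_prod:
  assumes "m \<ge> 1" "t \<in> increasing_tuples m"
  shows "x_word 0 (t m) (x_prod m a t)"
  using assms
proof (induction m rule: nat_induct_at_least)
  case base
  then have "0 < t 1" by (auto simp: increasing_tuples_def)
  then show ?case
    using x_word.single[of 0 "t 1" "t 1" "a 1" "a 2"] by (simp add: x_prod_1[abs_def])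
next
  case (Suc m)
  have "t m < t (Suc m)"
    using Suc.prems Suc.hyps by (auto simp: increasing_tuples_def strict_mono_on_def)
  moreover have "t \<in> increasing_tuples m"
    using Suc.prems by (auto simp: increasing_tuples_def strict_mono_on_def)
  moreover have "x_prod (Suc m) a t = (\<lambda>f. x_prod m a t f * f (t (Suc m)) * a (Suc (Suc m)))"
    using Suc.hyps by (simp add: fun_eq_iff x_prod_Suc)
  ultimately show ?case
    using x_word.snoc[OF Suc.IH, of "t (Suc m)" "t (Suc m)" "a (Suc (Suc m))"] by simp
qed

lemma x_word_imp_x_prod:
  assumes "x_word lo hi w"
  obtains m a t where "m \<ge> 1" "t \<in> increasing_tuples m" "t m \<le> hi" "w = x_prod m a t"
proof -
  have "\<exists>m a t. m \<ge> 1 \<and> t \<in> increasing_tuples m \<and> t m \<le> hi \<and> w = x_prod m a t"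
    using assms
  proof (induction rule: x_word.induct)
    case (single lo t hi a b)
    show ?case
      using single
      by (intro exI[of _ 1] exI[of _ "\<lambda>j. if j = 1 then a else b"] exI[of _ "\<lambda>_. t"])
        (auto simp: increasing_tuples_def strict_mono_on_def x_prod_1)
  next
    case (snoc lo k w s hi b)
    then obtain m a t where m: "m \<ge> 1" and t: "t \<in> increasing_tuples m" "t m \<le> k"
      and w: "w = x_prod m a t"
      by blast
    \<comment> \<open>Both updates lie outside the entries that \<open>x_prod m\<close> reads, so
      the shorter product keeps its value.\<close>
    let ?a = "a(Suc (Suc m) := b)" and ?t = "t(Suc m := s)"
    have "t j < s" if "j \<in> {1..m}" for j
    proof -
      have "t j \<le> t m"
        using that t(1)
        by (cases "j = m") (auto simp: increasing_tuples_def strict_mono_on_def less_imp_le)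
      then show ?thesis using t(2) snoc.hyps by simp
    qed
    then have "?t \<in> increasing_tuples (Suc m)"
      using t(1) snoc.hyps by (auto simp: increasing_tuples_def strict_mono_on_def)
    moreover have "x_prod m ?a ?t f = w f" for f
      unfolding w using m by (intro x_prod_cong) auto
    then have "(\<lambda>f. w f * f s * b) = x_prod (Suc m) ?a ?t"
      using m by (simp add: fun_eq_iff x_prod_Suc)
    moreover have "1 \<le> Suc m" "?t (Suc m) \<le> hi"
      using snoc.hyps by simp_all
    ultimately show ?case by blast
  qed
  then show ?thesis using that by blast
qed

lemma J_setI:
  assumes "\<And>F. finite F \<Longrightarrow> F \<noteq> {} \<Longrightarrow> \<exists>lo hi w. x_word lo hi w \<and> (\<forall>f\<in>F. w f \<in> B)"
  shows "J_set B"
  unfolding J_set_def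
proof (intro allI impI, elim conjE)
  fix F :: "(nat \<Rightarrow> 'a) set"
  assume "finite F" "F \<noteq> {}"
  then obtain lo hi w where "x_word lo hi w" and w: "\<forall>f\<in>F. w f \<in> B"
    using assms by blast
  then show "\<exists>m\<ge>1. \<exists>a. \<exists>t\<in>increasing_tuples m. \<forall>f\<in>F. x_prod m a t f \<in> B"
    by (metis x_word_imp_x_prod)
qed

text \<open>Applying the property to the sequences of \<open>F\<close> shifted by \<open>n\<close>
  moves every index of the witness beyond \<open>n\<close>.\<close>

lemma J_setE:
  fixes B :: "'a::semigroup_mult set" and F :: "(nat \<Rightarrow> 'a) set"
  assumes "J_set B" "finite F" "F \<noteq> {}"
  obtains hi w where "x_word n hi w" "\<forall>f\<in>F. w f \<in> B"
proof -
  let ?G = "(\<lambda>f i. f (i + n)) ` F"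
  obtain m a t where "m \<ge> 1" "t \<in> increasing_tuples m" and *: "\<forall>f\<in>?G. x_prod m a t f \<in> B"
    using assms unfolding J_set_def by (metis finite_imageI image_is_empty)
  then have "x_word n (t m + n) (\<lambda>f. x_prod m a t (\<lambda>i. f (i + n)))"
    using x_word_shift[OF x_word_x_prod, of m t n a] by simp
  with * that show ?thesis by blast
qed

lemma x_word_substitute:
  fixes h :: "nat \<Rightarrow> nat" and \<Phi> :: "'s::semigroup_mult \<Rightarrow> 't::semigroup_mult"
  assumes hom: "semigroup_hom \<Phi>"
    and block: "\<And>n. x_word (h n) (h (Suc n)) (W n)"
    and g: "\<And>f n. f \<in> F \<Longrightarrow> \<Phi> (g f n) = W n f"
    and "x_word p q v"
  shows "\<exists>u. x_word (h (Suc p)) (h (Suc q)) u \<and> (\<forall>f\<in>F. u f = \<Phi> (v (g f)))"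
proof -
  have mono: "h i \<le> h j" if "i \<le> j" for i j
    using lift_Suc_mono_le[of h i j] x_word_less[OF block] that by (simp add: less_imp_le)
  show ?thesis
    using \<open>x_word p q v\<close>
  proof (induction rule: x_word.induct)
    case (single p t q a b)
    \<comment> \<open>As \<open>p < t \<le> q\<close>, the block from \<open>h t\<close> to
      \<open>h (Suc t)\<close> fits between \<open>h (Suc p)\<close> and \<open>h (Suc q)\<close>;
      hence the \<open>Suc\<close> in both bounds.\<close>
    have "x_word (h (Suc p)) (h (Suc q)) (W t)"
      using single by (intro x_word_mono[OF block] mono) auto
    then have "x_word (h (Suc p)) (h (Suc q)) (\<lambda>f. \<Phi> a * W t f * \<Phi> b)"
      by (intro x_word_mult_left x_word_mult_right)
    moreover have "\<forall>f\<in>F. \<Phi> a * W t f * \<Phi> b = \<Phi> (a * g f t * b)"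
      using hom g by (simp add: semigroup_hom_def)
    ultimately show ?case by blast
  next
    case (snoc p k v t q b)
    then obtain u where u: "x_word (h (Suc p)) (h (Suc k)) u" "\<forall>f\<in>F. u f = \<Phi> (v (g f))"
      by blast
    \<comment> \<open>Since \<open>k < t\<close>, block \<open>t\<close> starts no earlier than
      \<open>h (Suc k)\<close>, the upper bound for \<open>u\<close>.\<close>
    have "x_word (h (Suc k)) (h (Suc q)) (W t)"
      using snoc.hyps by (intro x_word_mono[OF block] mono) auto
    then have "x_word (h (Suc p)) (h (Suc q)) (\<lambda>f. u f * W t f * \<Phi> b)"
      using u(1) by (intro x_word_mult_right x_word_mult)
    moreover have "\<forall>f\<in>F. u f * W t f * \<Phi> b = \<Phi> (v (g f) * g f t * b)"
      using hom g u(2) by (simp add: semigroup_hom_def)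
    ultimately show ?case by blast
  qed
qed

theorem theorem3p4:
  fixes \<Phi> :: "'s::semigroup_mult \<Rightarrow> 't::semigroup_mult"
    and A :: "'s set"
  assumes "semigroup_hom \<Phi>"
    and "J_set (range \<Phi>)"
    and "J_set A"
  shows "J_set (\<Phi> ` A)"
proof (rule J_setI)
  fix F :: "(nat \<Rightarrow> 't) set"
  assume F: "finite F" "F \<noteq> {}"
  have "\<exists>hi w. x_word n hi w \<and> (\<forall>f\<in>F. w f \<in> range \<Phi>)" for n
    using J_setE[OF assms(2) F, of n] by metis
  then obtain H V where HV: "\<And>n. x_word n (H n) (V n)" "\<And>n f. f \<in> F \<Longrightarrow> V n f \<in> range \<Phi>"
    by metis
  \<comment> \<open>Iterating \<open>H\<close> makes each block start at the bound where the
    previous one ends.\<close>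
  define h where "h n = (H ^^ n) 0" for n
  \<comment> \<open>For \<open>f \<in> F\<close> this is a genuine preimage, because
    \<open>V (h n) f\<close> lies in the range of \<open>\<Phi>\<close>; for other \<open>f\<close>
    it may be arbitrary.\<close>
  define g where "g f n = inv \<Phi> (V (h n) f)" for f n
  have block: "x_word (h n) (h (Suc n)) (V (h n))" for n
    using HV(1) by (simp add: h_def)
  have g: "\<Phi> (g f n) = V (h n) f" if "f \<in> F" for f n
    using HV(2)[OF that] by (simp add: g_def f_inv_into_f)
  obtain q v where "x_word 0 q v" and v: "\<forall>f\<in>g ` F. v f \<in> A"
    using J_setE[OF assms(3), of "g ` F" 0] F by auto
  then obtain u where "x_word (h (Suc 0)) (h (Suc q)) u" "\<forall>f\<in>F. u f = \<Phi> (v (g f))"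
    using x_word_substitute[of \<Phi> h "\<lambda>n. V (h n)" F g 0 q v] assms(1) block g by blast
  with v show "\<exists>lo hi w. x_word lo hi w \<and> (\<forall>f\<in>F. w f \<in> \<Phi> ` A)"
    by blast
qed

end
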